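(* For every parameter $\mathcal{P}=\langle V,T,F\rangle$ and all sets of formulas $\Gamma,\Delta$: $\Gamma \vDash_{\mathcal{P}} \Delta$ if and only if $\Gamma \vDash_{C} \Delta$.
   Context: Fix a first-order language with connectives $\neg,\wedge,\vee,\to$ and quantifiers $\forall,\exists$; terms are variables and constants. A model is a pair $M=\langle D,I\rangle$ with $D$ a nonempty domain, $I(t)\in D$ for every term $t$, and for each $n$-ary predicate $P$, $I(P)$ a function $D^n\to[0,1]$. Values of formulas: $I(P(t_1,\dots,t_n))=I(P)(I(t_1),\dots,I(t_n))$; $I(\neg A)=1-I(A)$; $I(A\wedge B)=\min(I(A),I(B))$; $I(A\vee B)=\max(I(A),I(B))$; $I(A\to B)=\max(1-I(A),I(B))$; $I(\forall x A(x))$ is the greatest lower bound and $I(\exists xA(x))$ the least upper bound of $\{I'(A(x)) : I' \text{ an } x\text{-variant of } I\}$ (an $x$-variant agrees with $I$ except possibly on the variable $x$). We write $M(A)$ for $I(A)$. An argument is a pair $\Gamma\Rightarrow\Delta$ of sets of formulas. A set $V\subseteq[0,1]$ is closed if it is closed under greatest lower bounds and least upper bounds of arbitrary subsets and under $x\mapsto 1-x$. $X\subseteq[0,1]$ is an upset if $x\in X$, $x<y\le 1$ imply $y\in X$; a downset if $x\in X$, $x>y\ge 0$ imply $y\in X$. A parameter is a triple $\langle V,T,F\rangle$ with $\{0,1\}\subseteq V\subseteq[0,1]$ closed, $1\in T\subseteq(0.5,1]$ an upset, and $0\in F\subseteq[0,0.5)$ a downset. A model $M$ is a $\mathcal{P}$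 countermodel to $\Gamma\Rightarrow\Delta$ iff $M(A)\in V$ for every formula $A$, $M(\gamma)\in T$ for all $\gamma\in\Gamma$, and $M(\delta)\in F$ for all $\delta\in\Delta$; $\Gamma\vDash_{\mathcal{P}}\Delta$ iff there is no $\mathcal{P}$ countermodel. Classical validity $\Gamma\vDash_C\Delta$ means there is no model $M$ with $M(A)\in\{0,1\}$ for every formula $A$, $M(\gamma)=1$ for all $\gamma\in\Gamma$ and $M(\delta)=0$ for all $\delta\in\Delta$. *)

theory Defs
  imports Complex_Main "HOL-Library.Lub_Glb"
begin

record ('c, 'p) language =
  constants :: "'c set"
  predicates :: "'p set"
  arity :: "'p \<Rightarrow> nat"

datatype 'c tm = Var nat | Const 'c

datatype ('c, 'p) fm =
    Pred 'p "'c tm list"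
  | Neg "('c, 'p) fm"
  | Conj "('c, 'p) fm" "('c, 'p) fm"
  | Disj "('c, 'p) fm" "('c, 'p) fm"
  | Imp "('c, 'p) fm" "('c, 'p) fm"
  | Forall nat "('c, 'p) fm"
  | Exists nat "('c, 'p) fm"

definition tms :: "('c, 'p) language \<Rightarrow> 'c tm set" where
  "tms L = range Var \<union> Const ` constants L"

primrec wff :: "('c, 'p) language \<Rightarrow> ('c, 'p) fm \<Rightarrow> bool" where
  "wff L (Pred P ts) \<longleftrightarrow> P \<in> predicates L \<and> length ts = arity L P \<and> set ts \<subseteq> tms L"
| "wff L (Neg A) \<longleftrightarrow> wff L A"
| "wff L (Conj A B) \<longleftrightarrow> wff L A \<and> wff L B"
| "wff L (Disj A B) \<longleftrightarrow> wff L A \<and> wff L B"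
| "wff L (Imp A B) \<longleftrightarrow> wff L A \<and> wff L B"
| "wff L (Forall x A) \<longleftrightarrow> wff L A"
| "wff L (Exists x A) \<longleftrightarrow> wff L A"

definition fms :: "('c, 'p) language \<Rightarrow> ('c, 'p) fm set" where
  "fms L = {A. wff L A}"

text \<open>
  The fields \<open>itm\<close> and \<open>ipred\<close> are the interpretation \<open>I\<close> on terms (variables included) and on
  predicates. Elements of \<open>D\<^sup>n\<close> are lists over \<open>D\<close> of length \<open>n\<close>.
\<close>

record ('c, 'p, 'd) model =
  domain :: "'d set"
  itm :: "'c tm \<Rightarrow> 'd"
  ipred :: "'p \<Rightarrow> 'd list \<Rightarrow> real"

definition is_model :: "('c, 'p) language \<Rightarrow> ('c, 'p, 'd) model \<Rightarrow> bool" where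
  "is_model L M \<longleftrightarrow>
     domain M \<noteq> {} \<and>
     (\<forall>t \<in> tms L. itm M t \<in> domain M) \<and>
     (\<forall>P \<in> predicates L. \<forall>ds. length ds = arity L P \<and> set ds \<subseteq> domain M
        \<longrightarrow> ipred M P ds \<in> {0..1})"

definition variants :: "nat \<Rightarrow> ('c, 'p, 'd) model \<Rightarrow> ('c, 'p, 'd) model set" where
  "variants x M = {M\<lparr>itm := (itm M)(Var x := d)\<rparr> | d. d \<in> domain M}"

primrec fval :: "('c, 'p, 'd) model \<Rightarrow> ('c, 'p) fm \<Rightarrow> real" where
  "fval M (Pred P ts) = ipred M P (map (itm M) ts)"
| "fval M (Neg A) = 1 - fval M A"
| "fval M (Conj A B) = min (fval M A) (fval M B)"
| "fval M (Disj A B) = max (fval M A) (fval M B)"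
| "fval M (Imp A B) = max (1 - fval M A) (fval M B)"
| "fval M (Forall x A) = (INF M' \<in> variants x M. fval M' A)"
| "fval M (Exists x A) = (SUP M' \<in> variants x M. fval M' A)"

text \<open>
  Bounds are taken relative to the ambient order \<open>[0,1]\<close>, so that the empty subset is covered
  too (its greatest lower bound is 1, its least upper bound 0).
\<close>

definition closed_values :: "real set \<Rightarrow> bool" where
  "closed_values V \<longleftrightarrow>
     (\<forall>X \<subseteq> V. \<forall>m. isGlb {0..1} X m \<longrightarrow> m \<in> V) \<and>
     (\<forall>X \<subseteq> V. \<forall>m. isLub {0..1} X m \<longrightarrow> m \<in> V) \<and>
     (\<forall>x \<in> V. 1 - x \<in> V)"

definition upset :: "real set \<Rightarrow> bool" where
  "upset X \<longleftrightarrow> X \<subseteq> {0..1} \<and> (\<forall>x \<in> X. \<forall>y. x < y \<and> y \<le> 1 \<longrightarrow> y \<in> X)"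

definition downset :: "real set \<Rightarrow> bool" where
  "downset X \<longleftrightarrow> X \<subseteq> {0..1} \<and> (\<forall>x \<in> X. \<forall>y. x > y \<and> y \<ge> 0 \<longrightarrow> y \<in> X)"

type_synonym param = "real set \<times> real set \<times> real set"

definition is_parameter :: "param \<Rightarrow> bool" where
  "is_parameter = (\<lambda>(V, T, F).
     {0, 1} \<subseteq> V \<and> V \<subseteq> {0..1} \<and> closed_values V \<and>
     1 \<in> T \<and> T \<subseteq> {1/2<..1} \<and> upset T \<and>
     0 \<in> F \<and> F \<subseteq> {0..<1/2} \<and> downset F)"

definition countermodel ::
  "('c, 'p) language \<Rightarrow> param \<Rightarrow> ('c, 'p) fm set \<Rightarrow> ('c, 'p) fm set \<Rightarrow> ('c, 'p, 'd) model \<Rightarrow> bool"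
where
  "countermodel L = (\<lambda>(V, T, F) \<Gamma> \<Delta> M.
     is_model L M \<and>
     (\<forall>A \<in> fms L. fval M A \<in> V) \<and>
     (\<forall>\<gamma> \<in> \<Gamma>. fval M \<gamma> \<in> T) \<and>
     (\<forall>\<delta> \<in> \<Delta>. fval M \<delta> \<in> F))"

text \<open>
  HOL cannot quantify over all domains at once, so validity takes as argument the type from which
  the domains (arbitrary nonempty subsets of that type) are drawn.
\<close>

definition param_valid ::
  "'d itself \<Rightarrow> ('c, 'p) language \<Rightarrow> param \<Rightarrow> ('c, 'p) fm set \<Rightarrow> ('c, 'p) fm set \<Rightarrow> bool"
where
  "param_valid (_ :: 'd itself) L \<P> \<Gamma> \<Delta> \<longleftrightarrow>
     \<not> (\<exists>M :: ('c, 'p, 'd) model. countermodel L \<P> \<Gamma> \<Delta> M)"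

definition classically_valid ::
  "'d itself \<Rightarrow> ('c, 'p) language \<Rightarrow> ('c, 'p) fm set \<Rightarrow> ('c, 'p) fm set \<Rightarrow> bool"
where
  "classically_valid (_ :: 'd itself) L \<Gamma> \<Delta> \<longleftrightarrow>
     \<not> (\<exists>M :: ('c, 'p, 'd) model.
          is_model L M \<and>
          (\<forall>A \<in> fms L. fval M A \<in> {0, 1}) \<and>
          (\<forall>\<gamma> \<in> \<Gamma>. fval M \<gamma> = 1) \<and>
          (\<forall>\<delta> \<in> \<Delta>. fval M \<delta> = 0))"

end

theory Submission
  imports Defs
begin

text \<open>
  A classical countermodel is a countermodel for every parameter. Conversely, round every predicate
  value of a countermodel to 0 or 1, away from the midpoint 1/2 (values equal to 1/2 may go either
  way). By induction on formulas, every formula whose value was above (below) 1/2 receives the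
  value 1 (0) in the rounded model; since \<open>T\<close> lies above and \<open>F\<close> below 1/2, the rounded model is a
  classical countermodel on the same domain.
\<close>

text \<open>A relation rather than a function, because a fixed choice at 1/2 does not commute with
  the semantics. If 1/2 always went to 0, negation would fix 1/2 but take 0 to 1. Likewise, values
  above 1/2 can have infimum 1/2 while all of them round to 1.\<close>

definition rounds_to :: "real \<Rightarrow> real \<Rightarrow> bool" where
  "rounds_to r s \<longleftrightarrow> s \<in> {0, 1} \<and> (r > 1/2 \<longrightarrow> s = 1) \<and> (r < 1/2 \<longrightarrow> s = 0)"

text \<open>The image is a nonempty subset of a two-element set, hence finite, so both bounds are
  attained.\<close>

lemma crisp_INF_SUP:
  fixes g :: "'a \<Rightarrow> real"
  assumes "X \<noteq> {}" and g: "\<And>i. i \<in> X \<Longrightarrow> g i \<in> {0, 1}"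
  shows "(INF i\<in>X. g i) \<in> {0, 1}" and "(SUP i\<in>X. g i) \<in> {0, 1}"
proof -
  have sub: "g ` X \<subseteq> {0, 1}" using g by blast
  have fin: "finite (g ` X)" by (rule finite_subset[OF sub]) simp
  have ne: "g ` X \<noteq> {}" using assms(1) by simp
  show "(INF i\<in>X. g i) \<in> {0, 1}"
    using Min_in[OF fin ne] sub unfolding cInf_eq_Min[OF fin ne] by blast
  show "(SUP i\<in>X. g i) \<in> {0, 1}"
    using Max_in[OF fin ne] sub unfolding cSup_eq_Max[OF fin ne] by blast
qed

text \<open>An infimum above 1/2 forces every \<open>f i\<close> above 1/2. An infimum below 1/2
  need not be attained, but some \<open>f i\<close> is already below 1/2, and its rounding 0 pulls
  the other infimum down. An infimum equal to 1/2 demands only a value in {0, 1}.\<close>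

lemma rounds_to_INF:
  assumes "X \<noteq> {}"
    and f: "\<And>i. i \<in> X \<Longrightarrow> f i \<in> {0..1}"
    and r: "\<And>i. i \<in> X \<Longrightarrow> rounds_to (f i) (g i)"
  shows "rounds_to (INF i\<in>X. f i) (INF i\<in>X. g i)"
proof -
  have crisp: "g i \<in> {0, 1}" if "i \<in> X" for i
    using r[OF that] by (simp add: rounds_to_def)
  have bf: "bdd_below (f ` X)" using f by (auto intro!: bdd_belowI2[where m = 0])
  have bg: "bdd_below (g ` X)" using crisp by (force intro!: bdd_belowI2[where m = 0])
  have mem: "(INF i\<in>X. g i) \<in> {0, 1}"
    using assms(1) crisp by (rule crisp_INF_SUP(1))
  have "(INF i\<in>X. g i) = 1" if "(INF i\<in>X. f i) > 1/2"
  proof -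
    have "g i = 1" if "i \<in> X" for i
      using \<open>1/2 < (INF i\<in>X. f i)\<close> cINF_lower[OF bf that] r[OF that]
      by (simp add: rounds_to_def)
    then show ?thesis using assms(1) by simp
  qed
  moreover have "(INF i\<in>X. g i) = 0" if "(INF i\<in>X. f i) < 1/2"
  proof -
    obtain i where i: "i \<in> X" "f i < 1/2"
      using \<open>(INF i\<in>X. f i) < 1/2\<close> cINF_less_iff[OF assms(1) bf] by blast
    then have "g i = 0" using r by (simp add: rounds_to_def)
    then have "(INF i\<in>X. g i) \<le> 0" using cINF_lower[OF bg i(1)] by simp
    then show ?thesis using mem by auto
  qed
  ultimately show ?thesis using mem by (simp add: rounds_to_def)
qed

text \<open>Order dual of \<open>rounds_to_INF\<close>: here a supremum above 1/2 is the case that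
  needs a witness.\<close>

lemma rounds_to_SUP:
  assumes "X \<noteq> {}"
    and f: "\<And>i. i \<in> X \<Longrightarrow> f i \<in> {0..1}"
    and r: "\<And>i. i \<in> X \<Longrightarrow> rounds_to (f i) (g i)"
  shows "rounds_to (SUP i\<in>X. f i) (SUP i\<in>X. g i)"
proof -
  have crisp: "g i \<in> {0, 1}" if "i \<in> X" for i
    using r[OF that] by (simp add: rounds_to_def)
  have bf: "bdd_above (f ` X)" using f by (auto intro!: bdd_aboveI2[where M = 1])
  have bg: "bdd_above (g ` X)" using crisp by (force intro!: bdd_aboveI2[where M = 1])
  have mem: "(SUP i\<in>X. g i) \<in> {0, 1}"
    using assms(1) crisp by (rule crisp_INF_SUP(2))
  have "(SUP i\<in>X. g i) = 0" if "(SUP i\<in>X. f i) < 1/2"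
  proof -
    have "g i = 0" if "i \<in> X" for i
      using \<open>(SUP i\<in>X. f i) < 1/2\<close> cSUP_upper[OF that bf] r[OF that]
      by (simp add: rounds_to_def)
    then show ?thesis using assms(1) by simp
  qed
  moreover have "(SUP i\<in>X. g i) = 1" if "(SUP i\<in>X. f i) > 1/2"
  proof -
    obtain i where i: "i \<in> X" "f i > 1/2"
      using \<open>(SUP i\<in>X. f i) > 1/2\<close> less_cSUP_iff[OF assms(1) bf] by blast
    then have "g i = 1" using r by (simp add: rounds_to_def)
    then have "(SUP i\<in>X. g i) \<ge> 1" using cSUP_upper[OF i(1) bg] by simp
    then show ?thesis using mem by auto
  qed
  ultimately show ?thesis using mem by (simp add: rounds_to_def)
qed

lemma is_model_variant:
  assumes "is_model L M" "M' \<in> variants x M"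
  shows "is_model L M'"
  using assms by (auto simp: is_model_def variants_def)

lemma variants_nonempty: "is_model L M \<Longrightarrow> variants x M \<noteq> {}"
  by (auto simp: is_model_def variants_def)

text \<open>Supplies the boundedness without which \<open>INF\<close> and \<open>SUP\<close> on the
  reals need not be the intended bounds. Well-formedness matters for atoms: \<open>is_model\<close>
  constrains predicates only on argument lists of the right length over the domain.\<close>

lemma fval_in_unit_interval:
  assumes "is_model L M" "wff L A"
  shows "fval M A \<in> {0..1}"
  using assms
proof (induction A arbitrary: M)
  case (Pred P ts)
  have "set (map (itm M) ts) \<subseteq> domain M"
    using Pred by (auto simp: is_model_def)
  then show ?case
    using Pred by (simp add: is_model_def)
next
  case (Forall x A)
  have v: "fval M' A \<in> {0..1}" if "M' \<in> variants x M" for M'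
    using Forall is_model_variant that by (metis wff.simps(6))
  obtain M0 where M0: "M0 \<in> variants x M" using variants_nonempty[OF Forall.prems(1)] by blast
  have "bdd_below ((\<lambda>M'. fval M' A) ` variants x M)"
    using v by (auto intro!: bdd_belowI2[where m = 0])
  then have "(INF M'\<in>variants x M. fval M' A) \<le> 1"
    using cINF_lower2[OF _ M0] v[OF M0] by auto
  moreover have "(INF M'\<in>variants x M. fval M' A) \<ge> 0"
    using v M0 by (intro cINF_greatest) auto
  ultimately show ?case by simp
next
  case (Exists x A)
  have v: "fval M' A \<in> {0..1}" if "M' \<in> variants x M" for M'
    using Exists is_model_variant that by (metis wff.simps(7))
  obtain M0 where M0: "M0 \<in> variants x M" using variants_nonempty[OF Exists.prems(1)] by blast
  have "bdd_above ((\<lambda>M'. fval M' A) ` variants x M)"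
    using v by (auto intro!: bdd_aboveI2[where M = 1])
  then have "(SUP M'\<in>variants x M. fval M' A) \<ge> 0"
    using cSUP_upper2[OF _ M0] v[OF M0] by auto
  moreover have "(SUP M'\<in>variants x M. fval M' A) \<le> 1"
    using v M0 by (intro cSUP_least) auto
  ultimately show ?case by simp
qed force+

definition rounded :: "('c, 'p, 'd) model \<Rightarrow> ('c, 'p, 'd) model" where
  "rounded M = M\<lparr>ipred := \<lambda>P ds. if ipred M P ds > 1/2 then 1 else 0\<rparr>"

lemma is_model_rounded: "is_model L M \<Longrightarrow> is_model L (rounded M)"
  by (auto simp: is_model_def rounded_def)

text \<open>Rounding alters only predicates and a variant alters only one variable, so the two
  operations commute.\<close>

lemma variants_rounded: "variants x (rounded M) = rounded ` variants x M"
  by (force simp: variants_def rounded_def)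

lemma rounds_to_fval_rounded:
  assumes "is_model L M" "wff L A"
  shows "rounds_to (fval M A) (fval (rounded M) A)"
  using assms
proof (induction A arbitrary: M)
  case (Pred P ts)
  then show ?case by (simp add: rounded_def rounds_to_def)
next
  case (Neg A)
  then have "rounds_to (fval M A) (fval (rounded M) A)" by simp
  \<comment> \<open>The map r to 1 - r reflects the interval about 1/2 and swaps 0 with 1.\<close>
  then show ?case by (auto simp: rounds_to_def)
next
  case (Conj A B)
  then have "rounds_to (fval M A) (fval (rounded M) A)" "rounds_to (fval M B) (fval (rounded M) B)"
    by simp_all
  then show ?case by (auto simp: rounds_to_def min_less_iff_disj)
next
  case (Disj A B)
  then have "rounds_to (fval M A) (fval (rounded M) A)" "rounds_to (fval M B) (fval (rounded M) B)"
    by simp_all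
  then show ?case by (auto simp: rounds_to_def less_max_iff_disj)
next
  case (Imp A B)
  then have "rounds_to (fval M A) (fval (rounded M) A)" "rounds_to (fval M B) (fval (rounded M) B)"
    by simp_all
  then show ?case by (auto simp: rounds_to_def max_def)
next
  case (Forall x A)
  \<comment> \<open>Both infima run over the variants of \<open>M\<close>, so the induction
    hypothesis applies index by index; \<open>variants_rounded\<close> then reindexes the second
    one.\<close>
  have "rounds_to (INF M'\<in>variants x M. fval M' A) (INF M'\<in>variants x M. fval (rounded M') A)"
    using Forall
    by (intro rounds_to_INF variants_nonempty fval_in_unit_interval) (auto intro: is_model_variant)
  then show ?case by (simp add: variants_rounded image_image)
next
  case (Exists x A)
  have "rounds_to (SUP M'\<in>variants x M. fval M' A) (SUP M'\<in>variants x M. fval (rounded M') A)"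
    using Exists
    by (intro rounds_to_SUP variants_nonempty fval_in_unit_interval) (auto intro: is_model_variant)
  then show ?case by (simp add: variants_rounded image_image)
qed

theorem theorem1:
  fixes L :: "('c, 'p) language"
    and \<P> :: param
    and \<Gamma> \<Delta> :: "('c, 'p) fm set"
  assumes "is_parameter \<P>"
    and "\<Gamma> \<subseteq> fms L"
    and "\<Delta> \<subseteq> fms L"
  shows "param_valid TYPE('d) L \<P> \<Gamma> \<Delta> \<longleftrightarrow> classically_valid TYPE('d) L \<Gamma> \<Delta>"
proof -
  obtain V T F where P: "\<P> = (V, T, F)" by (cases \<P>)
  have V: "{0, 1} \<subseteq> V" and T: "1 \<in> T" "T \<subseteq> {1/2<..1}" and F: "0 \<in> F" "F \<subseteq> {0..<1/2}"
    using assms(1) by (auto simp: P is_parameter_def)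
  define classical where "classical M \<longleftrightarrow> is_model L M \<and> (\<forall>A \<in> fms L. fval M A \<in> {0, 1}) \<and>
    (\<forall>\<gamma> \<in> \<Gamma>. fval M \<gamma> = 1) \<and> (\<forall>\<delta> \<in> \<Delta>. fval M \<delta> = 0)" for M :: "('c, 'p, 'd) model"
  have "countermodel L \<P> \<Gamma> \<Delta> M" if "classical M" for M
    using that V T(1) F(1) by (auto simp: P countermodel_def classical_def)
  moreover have "classical (rounded M)" if "countermodel L \<P> \<Gamma> \<Delta> M" for M
  proof -
    have M: "is_model L M" "\<forall>\<gamma> \<in> \<Gamma>. fval M \<gamma> > 1/2" "\<forall>\<delta> \<in> \<Delta>. fval M \<delta> < 1/2"
      using that T(2) F(2) by (auto simp: P countermodel_def)
    \<comment> \<open>Since \<open>rounds_to\<close> includes membership in {0, 1}, this yields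
      two-valuedness on all formulas as well as the values 1 on \<Gamma> and 0 on \<Delta>.\<close>
    have "rounds_to (fval M A) (fval (rounded M) A)" if "A \<in> fms L" for A
      using rounds_to_fval_rounded[OF M(1)] that by (simp add: fms_def)
    then show ?thesis
      using M assms(2,3) is_model_rounded[OF M(1)]
      unfolding classical_def rounds_to_def by blast
  qed
  ultimately show ?thesis
    unfolding param_valid_def classically_valid_def classical_def[symmetric] by blast
qed

end
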